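(* Let $(X,\mu,\mathcal{E},\mathcal{F})$ be a Dirichlet space with conservative heat semigroup $\{P_t\}_{t\in[0,\infty)}$. Let $\theta\in[0,1]$, $1\le q,r<+\infty$ and $\beta,\gamma>0$. Assume $\frac1p=\frac\theta q+\frac{1-\theta}r$ and $\alpha=\theta\beta+(1-\theta)\gamma$. Then $\mathbf B^{q,\beta}(X)\cap\mathbf B^{r,\gamma}(X)\subset\mathbf B^{p,\alpha}(X)$ and for any $f\in\mathbf B^{q,\beta}(X)\cap\mathbf B^{r,\gamma}(X)$, $$\|f\|_{p,\alpha}\le\|f\|_{q,\beta}^\theta\,\|f\|_{r,\gamma}^{1-\theta}.$$
   Context: $X$ is a good measurable space (the measure decomposition theorem holds and the $\sigma$-algebra is generated by a countable family; e.g. a Polish space) with a $\sigma$-finite measure $\mu$. A Dirichlet form is a densely defined closed symmetric form $(\mathcal{E},\mathcal{F})$ on $L^2(X,\mu)$ which is Markovian: if $u\in\mathcal F$ and $v$ satisfies $|v(x)-v(y)|\le|u(x)-u(y)|$ and $|v(x)|\le|u(x)|$ for a.e. $x,y$, then $v\in\mathcal F$ and $\mathcal E(v,v)\le\mathcal E(u,u)$. Then $(X,\mu,\mathcal E,\mathcal F)$ is called a Dirichlet space. $\{P_t\}_{t\ge0}$ is the associated self-adjoint sub-Markovian semigroup on $L^2(X,\mu)$ (the heat semigroup), extended to a contraction semigroup on every $L^p(X,\mu)$, $1\le p\le\infty$. It is conservative if $P_t1=1$ for all $t$; then there are probability kernels $p_t(x,dy)$ with $P_tf(x)=\int_Xf(y)\,p_t(x,dy)$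 for bounded or non-negative measurable $f$. For $p\ge1$, $\alpha\ge0$, $f\in L^p(X,\mu)$, $$\|f\|_{p,\alpha}=\sup_{t>0}t^{-\alpha}\left(\int_X\int_X|f(x)-f(y)|^p\,p_t(y,dx)\,d\mu(y)\right)^{1/p},$$ and $\mathbf B^{p,\alpha}(X)=\{f\in L^p(X,\mu):\|f\|_{p,\alpha}<+\infty\}$. *)

theory Defs
  imports "HOL-Probability.Probability"
begin

section \<open>Lebesgue spaces\<close>

text \<open>Real powers on \<open>[0, \<infinity>]\<close> for exponents \<open>a \<ge> 0\<close>, with the convention \<open>x\<^sup>0 = 1\<close>
  (whereas \<^term>\<open>(0::real) powr 0 = 0\<close>).\<close>

definition ennreal_rpow :: "ennreal \<Rightarrow> real \<Rightarrow> ennreal" where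
  "ennreal_rpow x a =
     (if a = 0 then 1 else if x = \<top> then \<top> else ennreal (enn2real x powr a))"

definition Lp_norm :: "'a measure \<Rightarrow> ennreal \<Rightarrow> ('a \<Rightarrow> real) \<Rightarrow> ennreal" where
  "Lp_norm M p f =
     (if p = \<top> then Inf {C. AE x in M. ennreal \<bar>f x\<bar> \<le> C}
      else ennreal_rpow (\<integral>\<^sup>+ x. ennreal (\<bar>f x\<bar> powr enn2real p) \<partial>M) (1 / enn2real p))"

text \<open>Elements of \<open>L\<^sup>p\<close> are represented by functions; equality in \<open>L\<^sup>p\<close> is equality almost
  everywhere.\<close>

definition Lp :: "'a measure \<Rightarrow> ennreal \<Rightarrow> ('a \<Rightarrow> real) set" where
  "Lp M p = {f \<in> borel_measurable M. Lp_norm M p f < \<top>}"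

definition L2_inner :: "'a measure \<Rightarrow> ('a \<Rightarrow> real) \<Rightarrow> ('a \<Rightarrow> real) \<Rightarrow> real" where
  "L2_inner M f g = (\<integral> x. f x * g x \<partial>M)"

section \<open>Good measurable spaces\<close>

text \<open>Disintegration of measures on the product space with respect to the first marginal.\<close>

definition measure_decomposition :: "'a measure \<Rightarrow> bool" where
  "measure_decomposition M \<longleftrightarrow>
     (\<forall>\<rho>. sets \<rho> = sets (M \<Otimes>\<^sub>M M) \<longrightarrow> finite_measure \<rho> \<longrightarrow>
        (\<exists>k \<in> M \<rightarrow>\<^sub>M prob_algebra M. \<forall>A \<in> sets M. \<forall>B \<in> sets M.
           emeasure \<rho> (A \<times> B) = (\<integral>\<^sup>+ x \<in> A. emeasure (k x) B \<partial>distr \<rho> M fst)))"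

definition good_measurable_space :: "'a measure \<Rightarrow> bool" where
  "good_measurable_space M \<longleftrightarrow>
     (\<exists>G. countable G \<and> G \<subseteq> Pow (space M) \<and> sets M = sigma_sets (space M) G) \<and>
     measure_decomposition M"

section \<open>Dirichlet spaces\<close>

text \<open>The form \<open>E\<close> is only meaningful on its domain \<open>F\<close>. The fourth conjunct of
  \<open>symmetric_form\<close> says that \<open>F\<close> and \<open>E\<close> live on classes of functions modulo equality almost
  everywhere.\<close>

definition symmetric_form ::
    "'a measure \<Rightarrow> (('a \<Rightarrow> real) \<Rightarrow> ('a \<Rightarrow> real) \<Rightarrow> real) \<Rightarrow> ('a \<Rightarrow> real) set \<Rightarrow> bool" where
  "symmetric_form M E F \<longleftrightarrow>
     F \<subseteq> Lp M 2 \<and>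
     (\<lambda>_. 0) \<in> F \<and>
     (\<forall>f\<in>F. \<forall>g\<in>F. \<forall>a b. (\<lambda>x. a * f x + b * g x) \<in> F) \<and>
     (\<forall>f\<in>F. \<forall>f' \<in> borel_measurable M. (AE x in M. f x = f' x) \<longrightarrow>
        f' \<in> F \<and> (\<forall>g\<in>F. E f' g = E f g)) \<and>
     (\<forall>f\<in>F. \<forall>g\<in>F. \<forall>h\<in>F. \<forall>a b. E (\<lambda>x. a * f x + b * g x) h = a * E f h + b * E g h) \<and>
     (\<forall>f\<in>F. \<forall>g\<in>F. E f g = E g f) \<and>
     (\<forall>f\<in>F. 0 \<le> E f f)"

definition densely_defined :: "'a measure \<Rightarrow> ('a \<Rightarrow> real) set \<Rightarrow> bool" where
  "densely_defined M F \<longleftrightarrow>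
     (\<forall>f \<in> Lp M 2. \<forall>e>0. \<exists>g\<in>F. Lp_norm M 2 (\<lambda>x. f x - g x) < e)"

definition form_norm_sq ::
    "'a measure \<Rightarrow> (('a \<Rightarrow> real) \<Rightarrow> ('a \<Rightarrow> real) \<Rightarrow> real) \<Rightarrow> ('a \<Rightarrow> real) \<Rightarrow> real" where
  "form_norm_sq M E f = E f f + L2_inner M f f"

definition closed_form ::
    "'a measure \<Rightarrow> (('a \<Rightarrow> real) \<Rightarrow> ('a \<Rightarrow> real) \<Rightarrow> real) \<Rightarrow> ('a \<Rightarrow> real) set \<Rightarrow> bool" where
  "closed_form M E F \<longleftrightarrow>
     (\<forall>u :: nat \<Rightarrow> 'a \<Rightarrow> real.
        (\<forall>n. u n \<in> F) \<longrightarrow>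
        (\<forall>e>0. \<exists>N. \<forall>m\<ge>N. \<forall>n\<ge>N. form_norm_sq M E (\<lambda>x. u m x - u n x) < e) \<longrightarrow>
        (\<exists>v\<in>F. (\<lambda>n. form_norm_sq M E (\<lambda>x. u n x - v x)) \<longlonglongrightarrow> 0))"

definition markovian_form ::
    "'a measure \<Rightarrow> (('a \<Rightarrow> real) \<Rightarrow> ('a \<Rightarrow> real) \<Rightarrow> real) \<Rightarrow> ('a \<Rightarrow> real) set \<Rightarrow> bool" where
  "markovian_form M E F \<longleftrightarrow>
     (\<forall>u\<in>F. \<forall>v \<in> borel_measurable M.
        (AE z in M \<Otimes>\<^sub>M M. \<bar>v (fst z) - v (snd z)\<bar> \<le> \<bar>u (fst z) - u (snd z)\<bar>) \<longrightarrow>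
        (AE x in M. \<bar>v x\<bar> \<le> \<bar>u x\<bar>) \<longrightarrow>
        v \<in> F \<and> E v v \<le> E u u)"

definition dirichlet_space ::
    "'a measure \<Rightarrow> (('a \<Rightarrow> real) \<Rightarrow> ('a \<Rightarrow> real) \<Rightarrow> real) \<Rightarrow> ('a \<Rightarrow> real) set \<Rightarrow> bool" where
  "dirichlet_space M E F \<longleftrightarrow>
     good_measurable_space M \<and> sigma_finite_measure M \<and>
     symmetric_form M E F \<and> densely_defined M F \<and> closed_form M E F \<and> markovian_form M E F"

section \<open>The heat semigroup\<close>

text \<open>The graph of the generator \<open>L\<close> of the form, \<open>E(f, g) = - \<langle>L f, g\<rangle>\<close> for all \<open>g \<in> F\<close>.\<close>

definition form_generator ::
    "'a measure \<Rightarrow> (('a \<Rightarrow> real) \<Rightarrow> ('a \<Rightarrow> real) \<Rightarrow> real) \<Rightarrow> ('a \<Rightarrow> real) set \<Rightarrow>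
     ('a \<Rightarrow> real) \<Rightarrow> ('a \<Rightarrow> real) \<Rightarrow> bool" where
  "form_generator M E F f h \<longleftrightarrow>
     f \<in> F \<and> h \<in> Lp M 2 \<and> (\<forall>g\<in>F. E f g = - L2_inner M h g)"

text \<open>The graph of the infinitesimal generator of a semigroup on \<open>L\<^sup>2\<close>.\<close>

definition semigroup_generator ::
    "'a measure \<Rightarrow> (real \<Rightarrow> ('a \<Rightarrow> real) \<Rightarrow> 'a \<Rightarrow> real) \<Rightarrow>
     ('a \<Rightarrow> real) \<Rightarrow> ('a \<Rightarrow> real) \<Rightarrow> bool" where
  "semigroup_generator M P f h \<longleftrightarrow>
     f \<in> Lp M 2 \<and> h \<in> Lp M 2 \<and>
     ((\<lambda>t. Lp_norm M 2 (\<lambda>x. (P t f x - f x) / t - h x)) \<longlongrightarrow> 0) (at_right 0)"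

text \<open>A family of operators acting on representatives. Linearity and contractivity force
  \<open>P t\<close> to respect equality almost everywhere.\<close>

definition contraction_semigroup ::
    "'a measure \<Rightarrow> ennreal \<Rightarrow> (real \<Rightarrow> ('a \<Rightarrow> real) \<Rightarrow> 'a \<Rightarrow> real) \<Rightarrow> bool" where
  "contraction_semigroup M p P \<longleftrightarrow>
     (\<forall>t\<ge>0. \<forall>f \<in> Lp M p. P t f \<in> Lp M p \<and> Lp_norm M p (P t f) \<le> Lp_norm M p f) \<and>
     (\<forall>t\<ge>0. \<forall>f \<in> Lp M p. \<forall>g \<in> Lp M p. \<forall>a b.
        AE x in M. P t (\<lambda>y. a * f y + b * g y) x = a * P t f x + b * P t g x) \<and>
     (\<forall>f \<in> Lp M p. AE x in M. P 0 f x = f x) \<and>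
     (\<forall>s\<ge>0. \<forall>t\<ge>0. \<forall>f \<in> Lp M p. AE x in M. P (s + t) f x = P s (P t f) x)"

text \<open>On \<open>L\<^sup>2\<close>, \<open>P\<close> is the strongly continuous semigroup with the generator of the form. For
  \<open>p < \<infinity>\<close> its extension to \<open>L\<^sup>p\<close> is determined by density of \<open>L\<^sup>2 \<inter> L\<^sup>p\<close>; on
  \<open>L\<^sup>\<infinity>\<close>, where density fails, it is the dual of the semigroup on \<open>L\<^sup>1\<close> (last conjunct).\<close>

definition heat_semigroup ::
    "'a measure \<Rightarrow> (('a \<Rightarrow> real) \<Rightarrow> ('a \<Rightarrow> real) \<Rightarrow> real) \<Rightarrow> ('a \<Rightarrow> real) set \<Rightarrow>
     (real \<Rightarrow> ('a \<Rightarrow> real) \<Rightarrow> 'a \<Rightarrow> real) \<Rightarrow> bool" where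
  "heat_semigroup M E F P \<longleftrightarrow>
     (\<forall>p\<ge>1. contraction_semigroup M p P) \<and>
     (\<forall>f \<in> Lp M 2. ((\<lambda>t. Lp_norm M 2 (\<lambda>x. P t f x - f x)) \<longlongrightarrow> 0) (at_right 0)) \<and>
     (\<forall>f h. semigroup_generator M P f h \<longleftrightarrow> form_generator M E F f h) \<and>
     (\<forall>t\<ge>0. \<forall>f \<in> Lp M 2. \<forall>g \<in> Lp M 2. L2_inner M (P t f) g = L2_inner M f (P t g)) \<and>
     (\<forall>t\<ge>0. \<forall>f \<in> Lp M 2. (AE x in M. 0 \<le> f x \<and> f x \<le> 1) \<longrightarrow>
        (AE x in M. 0 \<le> P t f x \<and> P t f x \<le> 1)) \<and>
     (\<forall>t\<ge>0. \<forall>f \<in> Lp M \<top>. \<forall>g \<in> Lp M 1.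
        (\<integral>x. P t f x * g x \<partial>M) = (\<integral>x. f x * P t g x \<partial>M))"

definition conservative ::
    "'a measure \<Rightarrow> (real \<Rightarrow> ('a \<Rightarrow> real) \<Rightarrow> 'a \<Rightarrow> real) \<Rightarrow> bool" where
  "conservative M P \<longleftrightarrow> (\<forall>t\<ge>0. AE x in M. P t (\<lambda>_. 1) x = 1)"

text \<open>The action of \<open>P t\<close> on a non-negative, possibly infinite function \<open>f\<close>, as the monotone
  limit of \<open>P t (min f n)\<close>.\<close>

definition nonneg_extension ::
    "(real \<Rightarrow> ('a \<Rightarrow> real) \<Rightarrow> 'a \<Rightarrow> real) \<Rightarrow> real \<Rightarrow> ('a \<Rightarrow> ennreal) \<Rightarrow> 'a \<Rightarrow> ennreal" where
  "nonneg_extension P t f x = (SUP n::nat. ennreal (P t (\<lambda>y. enn2real (min (f y) (of_nat n))) x))"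

definition heat_kernel ::
    "'a measure \<Rightarrow> (real \<Rightarrow> ('a \<Rightarrow> real) \<Rightarrow> 'a \<Rightarrow> real) \<Rightarrow> (real \<Rightarrow> 'a \<Rightarrow> 'a measure) \<Rightarrow> bool" where
  "heat_kernel M P k \<longleftrightarrow>
     (\<forall>t\<ge>0.
        k t \<in> M \<rightarrow>\<^sub>M prob_algebra M \<and>
        (\<forall>f \<in> borel_measurable M. (\<exists>C. \<forall>x \<in> space M. \<bar>f x\<bar> \<le> C) \<longrightarrow>
           (AE x in M. P t f x = (\<integral>y. f y \<partial>k t x))) \<and>
        (\<forall>f \<in> borel_measurable M.
           (AE x in M. nonneg_extension P t f x = (\<integral>\<^sup>+ y. f y \<partial>k t x))))"

section \<open>Heat semigroup based Besov spaces\<close>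

definition besov_seminorm ::
    "'a measure \<Rightarrow> (real \<Rightarrow> 'a \<Rightarrow> 'a measure) \<Rightarrow> real \<Rightarrow> real \<Rightarrow> ('a \<Rightarrow> real) \<Rightarrow> ennreal" where
  "besov_seminorm M k p \<alpha> f =
     (SUP t\<in>{0<..}. ennreal (t powr (- \<alpha>)) *
        ennreal_rpow (\<integral>\<^sup>+ y. (\<integral>\<^sup>+ x. ennreal (\<bar>f x - f y\<bar> powr p) \<partial>k t y) \<partial>M) (1 / p))"

definition besov_space ::
    "'a measure \<Rightarrow> (real \<Rightarrow> 'a \<Rightarrow> 'a measure) \<Rightarrow> real \<Rightarrow> real \<Rightarrow> ('a \<Rightarrow> real) set" where
  "besov_space M k p \<alpha> = {f \<in> Lp M (ennreal p). besov_seminorm M k p \<alpha> f < \<top>}"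

end

theory Submission
  imports Defs
begin

text \<open>The claim is Hoelder's inequality on $X \times X$ for the measure $p_t(y,dx)\,d\mu(y)$,
  since $|u|^p = (|u|^q)^a (|u|^r)^b$ with $a = \theta p / q$, $b = (1-\theta) p / r$ and
  $a + b = 1$. The measure is not formed: Hoelder is applied once to the kernel and once
  to $\mu$. The powers of $t$ split in the same way as the integrals.\<close>

section \<open>Powers of extended non-negative reals\<close>

lemma ennreal_rpow_0 [simp]: "ennreal_rpow x 0 = 1"
  by (simp add: ennreal_rpow_def)

lemma ennreal_rpow_zero [simp]: "a \<noteq> 0 \<Longrightarrow> ennreal_rpow 0 a = 0"
  by (simp add: ennreal_rpow_def)

lemma ennreal_rpow_top [simp]: "a \<noteq> 0 \<Longrightarrow> ennreal_rpow \<top> a = \<top>"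
  by (simp add: ennreal_rpow_def)

lemma ennreal_rpow_ennreal:
  assumes "0 \<le> c" "a \<noteq> 0"
  shows "ennreal_rpow (ennreal c) a = ennreal (c powr a)"
  using assms by (simp add: ennreal_rpow_def)

lemma ennreal_rpow_ennreal_pos:
  assumes "0 < c"
  shows "ennreal_rpow (ennreal c) a = ennreal (c powr a)"
  using assms by (simp add: ennreal_rpow_def)

lemma ennreal_rpow_1 [simp]: "ennreal_rpow x 1 = x"
  by (cases x) (simp_all add: ennreal_rpow_ennreal)

lemma ennreal_rpow_eq_0_iff: "ennreal_rpow x a = 0 \<longleftrightarrow> x = 0 \<and> a \<noteq> 0"
  by (cases x; cases "a = 0") (auto simp: ennreal_rpow_ennreal)

lemma ennreal_rpow_less_top:
  assumes "x < \<top>"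
  shows "ennreal_rpow x a < \<top>"
  using assms by (auto simp: ennreal_rpow_def)

lemma ennreal_rpow_mono:
  assumes "x \<le> y" "0 \<le> a"
  shows "ennreal_rpow x a \<le> ennreal_rpow y a"
proof (cases "a = 0 \<or> y = \<top>")
  case True
  then show ?thesis by (cases "a = 0") auto
next
  case False
  then have "x \<noteq> \<top>" using assms(1) by (auto simp: top_unique)
  with False assms show ?thesis
    by (auto simp: ennreal_rpow_def less_top intro!: ennreal_leI powr_mono2 enn2real_mono)
qed

text \<open>The mixed case respects \<open>0 * \<top> = 0\<close> because a nonzero power fixes both
  \<open>0\<close> and \<open>\<top>\<close>; for \<open>a = 0\<close> all three powers are
  \<open>1\<close>.\<close>

lemma ennreal_rpow_mult:
  assumes "0 \<le> a"
  shows "ennreal_rpow (x * y) a = ennreal_rpow x a * ennreal_rpow y a"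
proof (cases "a = 0")
  case False
  show ?thesis
  proof (cases "x = \<top> \<or> y = \<top>")
    case True
    with False show ?thesis
      by (cases "x = 0"; cases "y = 0")
         (auto simp: ennreal_top_mult ennreal_mult_top ennreal_rpow_eq_0_iff)
  next
    case nontop: False
    then obtain c d where "x = ennreal c" "0 \<le> c" "y = ennreal d" "0 \<le> d"
      by (metis ennreal_cases)
    with False show ?thesis
      by (simp add: ennreal_mult[symmetric] ennreal_rpow_ennreal powr_mult)
  qed
qed simp

text \<open>A zero exponent on either level gives \<open>1\<close> on both sides, since powers of
  \<open>1\<close> are \<open>1\<close>; otherwise \<open>a * b\<close> is nonzero and the real rule
  for iterated powers applies.\<close>

lemma ennreal_rpow_rpow: "ennreal_rpow (ennreal_rpow x a) b = ennreal_rpow x (a * b)"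
proof (cases "a = 0 \<or> b = 0")
  case True
  then show ?thesis
    using ennreal_rpow_ennreal_pos[of 1 b] by auto
next
  case False
  then show ?thesis
    by (cases x) (simp_all add: ennreal_rpow_ennreal powr_powr)
qed

lemma borel_measurable_ennreal_rpow [measurable]:
  assumes [measurable]: "f \<in> borel_measurable M"
  shows "(\<lambda>x. ennreal_rpow (f x) a) \<in> borel_measurable M"
  unfolding ennreal_rpow_def by measurable

section \<open>Hoelder's inequality\<close>

text \<open>This is the weighted Young inequality at \<open>x / A\<close> and \<open>y / B\<close>,
  multiplied through by \<open>A powr a * B powr b\<close>. In Hoelder's inequality \<open>A\<close>
  and \<open>B\<close> are the two integrals; keeping them in real coefficients avoids division in
  \<open>ennreal\<close>.\<close>

lemma Youngs_inequality_ennreal_scaled: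
  fixes x y :: ennreal
  assumes ab: "0 < a" "0 < b" "a + b = 1" and AB: "0 < A" "0 < B"
  shows "ennreal_rpow x a * ennreal_rpow y b
    \<le> ennreal (A powr a * B powr b) * (ennreal (a / A) * x + ennreal (b / B) * y)"
proof (cases "x = \<top> \<or> y = \<top>")
  case True
  with ab AB show ?thesis
    by (auto simp: ennreal_mult_eq_top_iff)
next
  case False
  then obtain c d where cd: "x = ennreal c" "0 \<le> c" "y = ennreal d" "0 \<le> d"
    by (metis ennreal_cases)
  have "c powr a * d powr b \<le> (A powr a * B powr b) * (a / A * c + b / B * d)"
  \<comment> \<open>Young's inequality is applied to positive numbers; if \<open>c\<close> or
    \<open>d\<close> vanishes, so does the left side.\<close>
  proof (cases "c = 0 \<or> d = 0")
    case True
    then show ?thesis using cd ab AB by auto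
  next
    case False
    then have "(c / A) powr a * (d / B) powr b \<le> a * (c / A) + b * (d / B)"
      using cd ab AB by (intro Youngs_inequality_0) auto
    with AB have "(A powr a * B powr b) * ((c / A) powr a * (d / B) powr b)
        \<le> (A powr a * B powr b) * (a * (c / A) + b * (d / B))"
      by (intro mult_left_mono) auto
    with cd AB show ?thesis by (simp add: powr_divide)
  qed
  with cd ab AB show ?thesis
    by (simp add: ennreal_rpow_ennreal ennreal_mult[symmetric] ennreal_plus[symmetric]
        del: ennreal_plus)
qed

text \<open>Young's inequality is integrated after \<open>g\<close> and \<open>h\<close> are scaled
  by their integrals. Exponents with sum \<open>1\<close>, in place of conjugate exponents, include
  the endpoints, which occur for \<theta> = 0 and \<theta> = 1.\<close>

lemma nn_integral_Hoelder:
  assumes [measurable]: "g \<in> borel_measurable M" "h \<in> borel_measurable M"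
    and ab: "0 \<le> a" "0 \<le> b" "a + b = 1"
  shows "(\<integral>\<^sup>+ x. ennreal_rpow (g x) a * ennreal_rpow (h x) b \<partial>M)
    \<le> ennreal_rpow (\<integral>\<^sup>+ x. g x \<partial>M) a * ennreal_rpow (\<integral>\<^sup>+ x. h x \<partial>M) b"
    (is "?L \<le> ennreal_rpow ?G a * ennreal_rpow ?H b")
proof -
  \<comment> \<open>Scaling requires both integrals to be positive and finite, so only
    \<open>proper\<close> uses Young's inequality.\<close>
  consider (endpoint) "a = 0 \<or> b = 0" | (null) "0 < a" "0 < b" "?G = 0 \<or> ?H = 0"
    | (infinite) "0 < a" "0 < b" "?G \<noteq> 0" "?H \<noteq> 0" "?G = \<top> \<or> ?H = \<top>"
    | (proper) "0 < a" "0 < b" "?G \<noteq> 0" "?H \<noteq> 0" "?G \<noteq> \<top>" "?H \<noteq> \<top>"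
    using ab by fastforce
  then show ?thesis
  proof cases
    case endpoint
    then show ?thesis using ab by auto
  next
    case null
    \<comment> \<open>A vanishing integral makes its integrand vanish almost everywhere, and
      positive powers preserve the zero.\<close>
    then have "AE x in M. g x = 0 \<or> h x = 0"
      by (auto simp: nn_integral_0_iff_AE elim!: eventually_mono)
    then have "AE x in M. ennreal_rpow (g x) a * ennreal_rpow (h x) b = 0"
      using null by (auto elim!: eventually_mono)
    then have "?L = 0" by (simp add: nn_integral_0_iff_AE)
    then show ?thesis by simp
  next
    case infinite
    \<comment> \<open>Neither integral is zero, so the product \<open>0 * \<top>\<close> cannot
      arise.\<close>
    then have "ennreal_rpow ?G a * ennreal_rpow ?H b = \<top>"
      by (auto simp: ennreal_mult_eq_top_iff ennreal_rpow_eq_0_iff)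
    then show ?thesis by simp
  next
    case proper
    obtain A where A: "?G = ennreal A" "0 < A"
      using proper by (cases ?G) (auto simp: order_le_less)
    obtain B where B: "?H = ennreal B" "0 < B"
      using proper by (cases ?H) (auto simp: order_le_less)
    have "?L \<le> (\<integral>\<^sup>+ x. ennreal (A powr a * B powr b) *
        (ennreal (a / A) * g x + ennreal (b / B) * h x) \<partial>M)"
      using proper ab A B by (intro nn_integral_mono Youngs_inequality_ennreal_scaled)
    also have "\<dots> = ennreal (A powr a * B powr b) *
        (ennreal (a / A) * ennreal A + ennreal (b / B) * ennreal B)"
      by (simp add: nn_integral_cmult nn_integral_add A B)
    \<comment> \<open>The coefficients cancel against the integrals and leave the factor
      \<open>a + b = 1\<close>.\<close>
    also have "\<dots> = ennreal (A powr a * B powr b)"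
      using proper ab A B
      by (simp add: ennreal_mult[symmetric] ennreal_plus[symmetric] del: ennreal_plus)
    also have "\<dots> = ennreal_rpow ?G a * ennreal_rpow ?H b"
      using A B by (simp add: ennreal_rpow_ennreal_pos ennreal_mult)
    finally show ?thesis .
  qed
qed

lemma nn_integral_kernel_Hoelder:
  assumes K [measurable]: "K \<in> M \<rightarrow>\<^sub>M prob_algebra N"
    and [measurable]: "case_prod g \<in> borel_measurable (M \<Otimes>\<^sub>M N)"
      "case_prod h \<in> borel_measurable (M \<Otimes>\<^sub>M N)"
    and ab: "0 \<le> a" "0 \<le> b" "a + b = 1"
  shows "(\<integral>\<^sup>+ y. (\<integral>\<^sup>+ x. ennreal_rpow (g y x) a * ennreal_rpow (h y x) b \<partial>K y) \<partial>M)
    \<le> ennreal_rpow (\<integral>\<^sup>+ y. (\<integral>\<^sup>+ x. g y x \<partial>K y) \<partial>M) a *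
      ennreal_rpow (\<integral>\<^sup>+ y. (\<integral>\<^sup>+ x. h y x \<partial>K y) \<partial>M) b"
    (is "?L \<le> ?R")
proof -
  have K': "K \<in> M \<rightarrow>\<^sub>M subprob_algebra N"
    by (rule measurable_prob_algebraD[OF K])
  have "?L \<le> (\<integral>\<^sup>+ y. ennreal_rpow (\<integral>\<^sup>+ x. g y x \<partial>K y) a *
      ennreal_rpow (\<integral>\<^sup>+ x. h y x \<partial>K y) b \<partial>M)"
  proof (rule nn_integral_mono)
    fix y assume y: "y \<in> space M"
    have sets: "sets (K y) = sets N"
      using sets_kernel[OF K' y] .
    have "g y \<in> borel_measurable N" "h y \<in> borel_measurable N"
      using y assms(2,3) by (auto dest: measurable_Pair2)
    then have "g y \<in> borel_measurable (K y)" "h y \<in> borel_measurable (K y)"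
      using sets by (simp_all cong: measurable_cong_sets)
    then show "(\<integral>\<^sup>+ x. ennreal_rpow (g y x) a * ennreal_rpow (h y x) b \<partial>K y)
        \<le> ennreal_rpow (\<integral>\<^sup>+ x. g y x \<partial>K y) a * ennreal_rpow (\<integral>\<^sup>+ x. h y x \<partial>K y) b"
      using ab by (rule nn_integral_Hoelder)
  qed
  also have "\<dots> \<le> ?R"
    \<comment> \<open>The outer application takes the inner integrals as functions of
      \<open>y\<close>; their measurability comes from the kernel property
      \<open>K'\<close>.\<close>
    using ab K' by (intro nn_integral_Hoelder nn_integral_measurable_subprob_algebra2) auto
  finally show ?thesis .
qed

section \<open>Interpolation\<close>

locale interpolation_exponents =
  fixes \<theta> p q r :: real
  assumes theta: "0 \<le> \<theta>" "\<theta> \<le> 1" and q: "1 \<le> q" and r: "1 \<le> r"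
    and p: "1 / p = \<theta> / q + (1 - \<theta>) / r"
begin

definition a :: real where "a = \<theta> * p / q"
definition b :: real where "b = (1 - \<theta>) * p / r"

text \<open>Only the reciprocal of \<open>p\<close> is prescribed, and \<open>1 / 0 = 0\<close>;
  positivity follows because \<theta> and 1 - \<theta> cannot both vanish.\<close>

lemma p_pos: "0 < p"
proof -
  have "0 < \<theta> / q + (1 - \<theta>) / r"
  proof (cases "\<theta> = 0")
    case True
    then show ?thesis using r by simp
  next
    case False
    then show ?thesis using theta q r by (intro add_pos_nonneg) auto
  qed
  then show ?thesis by (metis p zero_less_divide_1_iff)
qed

lemma a_nonneg: "0 \<le> a" and b_nonneg: "0 \<le> b"
  using theta q r p_pos by (simp_all add: a_def b_def)

lemma a_plus_b: "a + b = 1"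
proof -
  have "a + b = p * (\<theta> / q + (1 - \<theta>) / r)"
    by (simp add: a_def b_def algebra_simps)
  then show ?thesis using p_pos by (simp flip: p)
qed

lemma a_over_p: "a * (1 / p) = (1 / q) * \<theta>" and b_over_p: "b * (1 / p) = (1 / r) * (1 - \<theta>)"
  using p_pos by (simp_all add: a_def b_def)

text \<open>The exponents add up: \<open>q * a + r * b\<close> equals \<theta> p + (1 - \<theta>) p
  = p.\<close>

lemma powr_split:
  "ennreal (\<bar>u\<bar> powr p) =
    ennreal_rpow (ennreal (\<bar>u\<bar> powr q)) a * ennreal_rpow (ennreal (\<bar>u\<bar> powr r)) b"
proof (cases "u = 0")
  case True
  \<comment> \<open>Since a zero exponent gives \<open>1\<close> even at \<open>0\<close>, some
    exponent must be nonzero for the product to vanish.\<close>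
  moreover have "a \<noteq> 0 \<or> b \<noteq> 0" using a_plus_b by auto
  ultimately show ?thesis by auto
next
  case False
  have "q * a + r * b = p"
    using q r by (simp add: a_def b_def field_simps)
  with False show ?thesis
    by (simp add: ennreal_rpow_ennreal_pos powr_powr ennreal_mult[symmetric]
        powr_add[symmetric])
qed

text \<open>The root of order \<open>p\<close> turns Hoelder's bound into a product of powers of
  norms. It serves both the Lebesgue norms and the double integrals of the seminorms.\<close>

lemma rpow_inverse_p:
  "ennreal_rpow (ennreal_rpow G a * ennreal_rpow H b) (1 / p) =
    ennreal_rpow (ennreal_rpow G (1 / q)) \<theta> * ennreal_rpow (ennreal_rpow H (1 / r)) (1 - \<theta>)"
  using p_pos by (simp only: ennreal_rpow_mult[of "1 / p"] ennreal_rpow_rpow a_over_p b_over_p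
      zero_le_divide_1_iff less_imp_le)

text \<open>Hoelder's inequality on \<open>M\<close> and a root of order \<open>p\<close> bound the
  norm by a product of finite powers. This gives the Lebesgue half of membership in
  \<open>besov_space\<close>.\<close>

lemma Lp_interpolation:
  assumes "f \<in> Lp M (ennreal q)" "f \<in> Lp M (ennreal r)"
  shows "f \<in> Lp M (ennreal p)"
proof -
  have f [measurable]: "f \<in> borel_measurable M" using assms by (simp add: Lp_def)
  have norm: "Lp_norm M (ennreal s) f =
      ennreal_rpow (\<integral>\<^sup>+ x. ennreal (\<bar>f x\<bar> powr s) \<partial>M) (1 / s)" if "0 < s" for s
    using that by (simp add: Lp_norm_def)
  have "(\<integral>\<^sup>+ x. ennreal (\<bar>f x\<bar> powr p) \<partial>M)
      \<le> ennreal_rpow (\<integral>\<^sup>+ x. ennreal (\<bar>f x\<bar> powr q) \<partial>M) a *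
        ennreal_rpow (\<integral>\<^sup>+ x. ennreal (\<bar>f x\<bar> powr r) \<partial>M) b"
    unfolding powr_split
    by (intro nn_integral_Hoelder a_nonneg b_nonneg a_plus_b) measurable
  then have "Lp_norm M (ennreal p) f \<le>
      ennreal_rpow (Lp_norm M (ennreal q) f) \<theta> * ennreal_rpow (Lp_norm M (ennreal r) f) (1 - \<theta>)"
    using q r p_pos by (simp add: norm ennreal_rpow_mono flip: rpow_inverse_p)
  also have "\<dots> < \<top>"
    using assms by (intro ennreal_mult_less_top[THEN iffD2])
      (auto simp: Lp_def intro!: ennreal_rpow_less_top)
  finally show ?thesis by (simp add: Lp_def)
qed

lemma besov_seminorm_interpolation:
  assumes f [measurable]: "f \<in> borel_measurable M"
    and k: "\<And>t. 0 < t \<Longrightarrow> k t \<in> M \<rightarrow>\<^sub>M prob_algebra M"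
  shows "besov_seminorm M k p (\<theta> * \<beta> + (1 - \<theta>) * \<gamma>) f \<le>
    ennreal_rpow (besov_seminorm M k q \<beta> f) \<theta> *
    ennreal_rpow (besov_seminorm M k r \<gamma> f) (1 - \<theta>)"
  \<comment> \<open>Only the supremum on the left is opened; those on the right serve as upper
    bounds for their terms at the same time \<open>t\<close>.\<close>
  unfolding besov_seminorm_def[of M k p]
proof (rule SUP_least)
  fix t :: real assume "t \<in> {0<..}"
  then have t: "0 < t" by simp
  define I where "I s = (\<integral>\<^sup>+ y. (\<integral>\<^sup>+ x. ennreal (\<bar>f x - f y\<bar> powr s) \<partial>k t y) \<partial>M)" for s
  have besov: "ennreal (t powr (- \<delta>)) * ennreal_rpow (I s) (1 / s) \<le> besov_seminorm M k s \<delta> f"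
    for s \<delta>
    unfolding besov_seminorm_def I_def using t by (intro SUP_upper) auto
  have "I p \<le> ennreal_rpow (I q) a * ennreal_rpow (I r) b"
    unfolding I_def powr_split
    by (rule nn_integral_kernel_Hoelder[OF k[OF t] _ _ a_nonneg b_nonneg a_plus_b]) measurable
  then have I: "ennreal_rpow (I p) (1 / p) \<le>
      ennreal_rpow (ennreal_rpow (I q) (1 / q)) \<theta> *
      ennreal_rpow (ennreal_rpow (I r) (1 / r)) (1 - \<theta>)"
    using p_pos by (simp add: ennreal_rpow_mono flip: rpow_inverse_p)
  have "ennreal (t powr - (\<theta> * \<beta> + (1 - \<theta>) * \<gamma>)) =
      ennreal_rpow (ennreal (t powr - \<beta>)) \<theta> * ennreal_rpow (ennreal (t powr - \<gamma>)) (1 - \<theta>)"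
    using t by (simp add: ennreal_rpow_ennreal_pos powr_powr ennreal_mult[symmetric]
        powr_add[symmetric] algebra_simps)
  then have "ennreal (t powr - (\<theta> * \<beta> + (1 - \<theta>) * \<gamma>)) * ennreal_rpow (I p) (1 / p) \<le>
      ennreal_rpow (ennreal (t powr - \<beta>)) \<theta> * ennreal_rpow (ennreal (t powr - \<gamma>)) (1 - \<theta>) *
      (ennreal_rpow (ennreal_rpow (I q) (1 / q)) \<theta> *
       ennreal_rpow (ennreal_rpow (I r) (1 / r)) (1 - \<theta>))"
    using I by (metis mult_left_mono zero_le)
  \<comment> \<open>Regrouping pairs each power of \<open>t\<close> with the integral of its own
    exponent, so that each factor is a power of one term of a supremum.\<close>
  also have "\<dots> = ennreal_rpow (ennreal (t powr - \<beta>) * ennreal_rpow (I q) (1 / q)) \<theta> *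
      ennreal_rpow (ennreal (t powr - \<gamma>) * ennreal_rpow (I r) (1 / r)) (1 - \<theta>)"
    using theta by (simp add: ennreal_rpow_mult mult_ac)
  also have "\<dots> \<le> ennreal_rpow (besov_seminorm M k q \<beta> f) \<theta> *
      ennreal_rpow (besov_seminorm M k r \<gamma> f) (1 - \<theta>)"
    using theta by (intro mult_mono ennreal_rpow_mono besov) auto
  finally show "ennreal (t powr - (\<theta> * \<beta> + (1 - \<theta>) * \<gamma>)) *
      ennreal_rpow (\<integral>\<^sup>+ y. (\<integral>\<^sup>+ x. ennreal (\<bar>f x - f y\<bar> powr p) \<partial>k t y) \<partial>M) (1 / p) \<le>
      ennreal_rpow (besov_seminorm M k q \<beta> f) \<theta> *
      ennreal_rpow (besov_seminorm M k r \<gamma> f) (1 - \<theta>)"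
    unfolding I_def .
qed

end

theorem proposition4p17:
  fixes M :: "'a measure"
    and E :: "('a \<Rightarrow> real) \<Rightarrow> ('a \<Rightarrow> real) \<Rightarrow> real"
    and F :: "('a \<Rightarrow> real) set"
    and P :: "real \<Rightarrow> ('a \<Rightarrow> real) \<Rightarrow> 'a \<Rightarrow> real"
    and k :: "real \<Rightarrow> 'a \<Rightarrow> 'a measure"
    and \<theta> p q r \<alpha> \<beta> \<gamma> :: real
  assumes "dirichlet_space M E F"
    and "heat_semigroup M E F P"
    and "conservative M P"
    and "heat_kernel M P k"
    and "0 \<le> \<theta>" and "\<theta> \<le> 1"
    and "1 \<le> q" and "1 \<le> r"
    and "0 < \<beta>" and "0 < \<gamma>"
    and "1 / p = \<theta> / q + (1 - \<theta>) / r"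
    and "\<alpha> = \<theta> * \<beta> + (1 - \<theta>) * \<gamma>"
  shows "besov_space M k q \<beta> \<inter> besov_space M k r \<gamma> \<subseteq> besov_space M k p \<alpha> \<and>
    (\<forall>f \<in> besov_space M k q \<beta> \<inter> besov_space M k r \<gamma>.
       besov_seminorm M k p \<alpha> f \<le>
         ennreal_rpow (besov_seminorm M k q \<beta> f) \<theta> *
         ennreal_rpow (besov_seminorm M k r \<gamma> f) (1 - \<theta>))"
proof -
  interpret interpolation_exponents \<theta> p q r
    by unfold_locales fact+
  have k: "k t \<in> M \<rightarrow>\<^sub>M prob_algebra M" if "0 < t" for t
    using assms(4) that by (simp add: heat_kernel_def)
  have "f \<in> besov_space M k p \<alpha> \<and> besov_seminorm M k p \<alpha> f \<le>
      ennreal_rpow (besov_seminorm M k q \<beta> f) \<theta> *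
      ennreal_rpow (besov_seminorm M k r \<gamma> f) (1 - \<theta>)"
    if f: "f \<in> besov_space M k q \<beta> \<inter> besov_space M k r \<gamma>" for f
  proof -
    have "f \<in> borel_measurable M" using f by (simp add: besov_space_def Lp_def)
    then have le: "besov_seminorm M k p \<alpha> f \<le>
        ennreal_rpow (besov_seminorm M k q \<beta> f) \<theta> *
        ennreal_rpow (besov_seminorm M k r \<gamma> f) (1 - \<theta>)"
      unfolding assms(12) using k by (rule besov_seminorm_interpolation)
    \<comment> \<open>Finiteness of the bound is the seminorm half of membership in the interpolated
      space.\<close>
    also have "\<dots> < \<top>"
      using f by (intro ennreal_mult_less_top[THEN iffD2])
        (auto simp: besov_space_def intro!: ennreal_rpow_less_top)
    finally have "f \<in> besov_space M k p \<alpha>"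
      using f by (auto simp: besov_space_def intro: Lp_interpolation)
    with le show ?thesis by simp
  qed
  then show ?thesis by blast
qed

end
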